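(* Let $S$ be a subordinator with Laplace exponent $\phi$ such that (A-2) and (A-3) hold, and let $t\mapsto\mu(t)$ be the decreasing density of its Lévy measure. Then $$\mu(t)\asymp t^{-2}\phi'(t^{-1}),\quad t\to0+ .$$
   Context: A subordinator $S=(S_t)_{t\ge0}$ is a Lévy process with values in $[0,\infty)$ started at $0$; its Laplace exponent $\phi$ is given by $\mathbb{E}e^{-\lambda S_t}=e^{-t\phi(\lambda)}$, $\lambda>0$, and $\phi(\lambda)=\gamma\lambda+\int_{(0,\infty)}(1-e^{-\lambda t})\mu(dt)$ with $\gamma\ge0$ and Lévy measure $\mu$ satisfying $\int_{(0,\infty)}(1\wedge t)\mu(dt)<\infty$. "Decreasing" means: $s\le t$ implies $f(s)\ge f(t)$. $f(t)\asymp g(t)$, $t\to0+$, means that $f(t)/g(t)$ stays between two positive constants as $t\to0+$. (A-2) $\mu(0,\infty)=\infty$ and $\mu$ has a decreasing density $t\mapsto\mu(t)$. (A-3) There exist constants $\sigma>0$, $\lambda_0>0$, $\delta>0$ such that $\frac{\phi'(\lambda x)}{\phi'(\lambda)}\le\sigma x^{-\delta}$ for all $x\ge1$ and $\lambda\ge\lambda_0$. *)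

theory Defs
  imports "HOL-Probability.Probability"
begin

locale levy_process = prob_space M for M :: "'a measure" +
  fixes X :: "real \<Rightarrow> 'a \<Rightarrow> real"
  assumes random_variable: "\<And>t. t \<ge> 0 \<Longrightarrow> X t \<in> borel_measurable M"
    and start_zero: "AE \<omega> in M. X 0 \<omega> = 0"
    and indep_increments:
      "\<And>(n::nat) t. 0 \<le> t 0 \<Longrightarrow> (\<And>i. i < n \<Longrightarrow> t i \<le> t (Suc i)) \<Longrightarrow>
         indep_vars (\<lambda>_. borel) (\<lambda>i \<omega>. X (t (Suc i)) \<omega> - X (t i) \<omega>) {..<n}"
    and stationary_increments:
      "\<And>s t. s \<ge> 0 \<Longrightarrow> t \<ge> 0 \<Longrightarrow>
         distr M borel (\<lambda>\<omega>. X (s + t) \<omega> - X s \<omega>) = distr M borel (\<lambda>\<omega>. X t \<omega> - X 0 \<omega>)"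
    and cadlag_paths:
      "AE \<omega> in M. (\<forall>t\<ge>0. ((\<lambda>s. X s \<omega>) \<longlongrightarrow> X t \<omega>) (at_right t)) \<and>
                  (\<forall>t>0. \<exists>l. ((\<lambda>s. X s \<omega>) \<longlongrightarrow> l) (at_left t))"

locale subordinator = levy_process M S for M :: "'a measure" and S :: "real \<Rightarrow> 'a \<Rightarrow> real" +
  assumes nonneg: "\<And>t \<omega>. t \<ge> 0 \<Longrightarrow> \<omega> \<in> space M \<Longrightarrow> S t \<omega> \<ge> 0"

text \<open>Only the values of \<open>\<phi>\<close> on the open half-line \<open>{0<..}\<close> are constrained.\<close>

definition is_laplace_exponent :: "'a measure \<Rightarrow> (real \<Rightarrow> 'a \<Rightarrow> real) \<Rightarrow> (real \<Rightarrow> real) \<Rightarrow> bool" where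
  "is_laplace_exponent M S \<phi> \<longleftrightarrow>
     (\<forall>t\<ge>0. \<forall>u>0. (\<integral>\<omega>. exp (- u * S t \<omega>) \<partial>M) = exp (- t * \<phi> u))"

text \<open>A Levy measure is a Borel measure whose underlying space is \<open>{0<..}\<close>, so that integrals
  with respect to it are integrals over \<open>{0<..}\<close>.\<close>

definition is_levy_measure :: "real measure \<Rightarrow> bool" where
  "is_levy_measure \<mu> \<longleftrightarrow>
     sets \<mu> = sets (restrict_space borel {0<..}) \<and> (\<integral>\<^sup>+t. ennreal (min 1 t) \<partial>\<mu>) < \<infinity>"

definition levy_khintchine :: "(real \<Rightarrow> real) \<Rightarrow> real \<Rightarrow> real measure \<Rightarrow> bool" where
  "levy_khintchine \<phi> \<gamma> \<mu> \<longleftrightarrow> \<gamma> \<ge> 0 \<and> is_levy_measure \<mu> \<and>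
     (\<forall>u>0. \<phi> u = \<gamma> * u + (\<integral>t. 1 - exp (- u * t) \<partial>\<mu>))"

definition has_density :: "real measure \<Rightarrow> (real \<Rightarrow> real) \<Rightarrow> bool" where
  "has_density \<mu> m \<longleftrightarrow>
     m \<in> borel_measurable (restrict_space borel {0<..}) \<and> (\<forall>t>0. m t \<ge> 0) \<and>
     \<mu> = density (restrict_space lborel {0<..}) (\<lambda>t. ennreal (m t))"

text \<open>Since \<open>x / 0 = 0\<close>, the bound \<open>0 < c \<le> f t / g t\<close> forces \<open>g t\<close> to be nonzero.\<close>

definition comparable :: "real filter \<Rightarrow> (real \<Rightarrow> real) \<Rightarrow> (real \<Rightarrow> real) \<Rightarrow> bool" where
  "comparable F f g \<longleftrightarrow>
     (\<exists>c>0. \<exists>C>0. \<forall>\<^sub>F t in F. c \<le> f t / g t \<and> f t / g t \<le> C)"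

end

theory Submission
  imports Defs
begin

text \<open>
  Write \<open>m\<close> for the decreasing density and
  \<open>L u = \<integral>t. t * exp (- u * t) \<partial>\<mu>\<close>. Differentiating the Levy-Khintchine formula under the
  integral gives \<open>\<phi>' = \<gamma> + L\<close>. The decay condition sends \<open>\<phi>'\<close> to \<open>0\<close> at infinity, so
  there is no drift and everything reduces to comparing \<open>m t\<close> with
  \<open>t powr (- 2) * L (1 / t)\<close>.

  The upper bound on \<open>m\<close> (\<open>density_le\<close>) is pure monotonicity: on \<open>(0, t]\<close> the density is at
  least \<open>m t\<close> and the exponential with \<open>u = 1 / t\<close> is at least \<open>exp (- 1)\<close>, so
  \<open>L (1 / t) \<ge> exp (- 1) * m t * t\<^sup>2 / 2\<close>.

  The lower bound (\<open>density_ge\<close>) splits the integral defining \<open>L u\<close> at \<open>t = a / u\<close> for a small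
  constant \<open>a\<close>. Beyond \<open>t\<close> the density is at most \<open>m t\<close>, which contributes at most
  \<open>2 * m t / u\<^sup>2\<close>. Below \<open>t\<close> the upper bound already proved and the decay
  condition together give \<open>s * m s \<le> K * (u * s) powr \<delta> * L u / s\<close>, and since \<open>\<delta> > 0\<close>
  this is integrable at \<open>0\<close>, with integral at most \<open>K * a powr \<delta> / \<delta> * L u\<close>. Choosing \<open>a\<close> so
  that \<open>K * a powr \<delta> / \<delta> \<le> 1 / 2\<close>, this part can be absorbed into the left-hand side,
  leaving \<open>L u \<le> 4 * m t / u\<^sup>2\<close>. As \<open>a \<le> 1\<close> and \<open>L\<close> is decreasing, \<open>L (1 / t) \<le> L u\<close>, and
  substituting \<open>u = a / t\<close> gives \<open>m t \<ge> a\<^sup>2 / 4 * t powr (- 2) * L (1 / t)\<close>.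
\<close>

section \<open>Differentiating the Laplace exponent\<close>

text \<open>The weight of the differentiated integral is dominated by the weight \<open>min 1 t\<close> against which
  every Levy measure is finite: it is at most \<open>t\<close>, and at most \<open>1 / u\<close> because
  \<open>u * t \<le> exp (u * t)\<close>.\<close>

lemma mult_exp_le_min:
  fixes u t :: real
  assumes "u > 0" "t > 0"
  shows "t * exp (- u * t) \<le> max 1 (1 / u) * min 1 t"
proof -
  have "u * t \<le> exp (u * t)"
    using exp_ge_add_one_self[of "u * t"] by linarith
  then have "t * exp (- u * t) \<le> 1 / u"
    using assms by (simp add: exp_minus field_simps)
  moreover have "t * exp (- u * t) \<le> t"
    using assms by simp
  moreover have "1 * t \<le> max 1 (1 / u) * t"
    using assms by (intro mult_right_mono) auto
  ultimately show ?thesis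
    by (cases "t \<le> 1") auto
qed

lemma levy_measure_space:
  assumes "is_levy_measure \<mu>"
  shows "space \<mu> = {0<..}"
  using assms sets_eq_imp_space_eq[of \<mu> "restrict_space borel {0<..}"]
  by (simp add: is_levy_measure_def space_restrict_space)

lemma levy_measure_measurable:
  fixes f :: "real \<Rightarrow> real"
  assumes "is_levy_measure \<mu>" and "f \<in> borel_measurable borel"
  shows "f \<in> borel_measurable \<mu>"
proof -
  have "sets \<mu> = sets (restrict_space borel {0<..})"
    using assms(1) by (simp only: is_levy_measure_def)
  from measurable_cong_sets[OF this refl] show ?thesis
    using measurable_restrict_space1[OF assms(2)] by metis
qed

lemma integrable_min_one:
  assumes "is_levy_measure \<mu>"
  shows "integrable \<mu> (\<lambda>t. min 1 t)"
proof (rule integrableI_nonneg)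
  show "(\<lambda>t. min 1 t) \<in> borel_measurable \<mu>"
    by (rule levy_measure_measurable[OF assms]) measurable
  show "AE t in \<mu>. 0 \<le> min 1 t"
    by (rule AE_I2) (simp add: levy_measure_space[OF assms])
  show "(\<integral>\<^sup>+ t. ennreal (min 1 t) \<partial>\<mu>) < \<infinity>"
    using assms by (simp add: is_levy_measure_def)
qed

lemma integrable_mult_exp:
  fixes u :: real
  assumes "is_levy_measure \<mu>" "u > 0"
  shows "integrable \<mu> (\<lambda>t. t * exp (- u * t))"
proof (rule Bochner_Integration.integrable_bound)
  show "integrable \<mu> (\<lambda>t. max 1 (1 / u) * min 1 t)"
    using integrable_min_one[OF assms(1)] by simp
  show "(\<lambda>t. t * exp (- u * t)) \<in> borel_measurable \<mu>"
    by (rule levy_measure_measurable[OF assms(1)]) measurable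
  show "AE t in \<mu>. norm (t * exp (- u * t)) \<le> norm (max 1 (1 / u) * min 1 t)"
  proof (rule AE_I2)
    fix t assume "t \<in> space \<mu>"
    then have t: "t > 0" by (simp add: levy_measure_space[OF assms(1)])
    show "norm (t * exp (- u * t)) \<le> norm (max 1 (1 / u) * min 1 t)"
      using mult_exp_le_min[OF assms(2) t] t by (simp add: abs_mult)
  qed
qed

lemma integrable_one_minus_exp:
  fixes u :: real
  assumes "is_levy_measure \<mu>" "u > 0"
  shows "integrable \<mu> (\<lambda>t. 1 - exp (- u * t))"
proof (rule Bochner_Integration.integrable_bound)
  show "integrable \<mu> (\<lambda>t. max 1 u * min 1 t)"
    using integrable_min_one[OF assms(1)] by simp
  show "(\<lambda>t. 1 - exp (- u * t)) \<in> borel_measurable \<mu>"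
    by (rule levy_measure_measurable[OF assms(1)]) measurable
  show "AE t in \<mu>. norm (1 - exp (- u * t)) \<le> norm (max 1 u * min 1 t)"
  proof (rule AE_I2)
    fix t assume "t \<in> space \<mu>"
    then have t: "t > 0" by (simp add: levy_measure_space[OF assms(1)])
    have "1 - exp (- u * t) \<le> u * t"
      using exp_ge_add_one_self[of "- u * t"] by linarith
    also have "\<dots> \<le> max 1 u * t"
      using t by (intro mult_right_mono) auto
    finally have "1 - exp (- u * t) \<le> max 1 u * t" .
    moreover have "1 - exp (- u * t) \<le> max 1 u"
      using exp_gt_zero[of "- u * t"] by linarith
    moreover have "0 \<le> 1 - exp (- u * t)"
      using assms t by simp
    moreover have "0 \<le> max 1 u * min 1 t"
      using t by simp
    ultimately show "norm (1 - exp (- u * t)) \<le> norm (max 1 u * min 1 t)"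
      by (cases "t \<le> 1") auto
  qed
qed

text \<open>The mean value theorem in the variable \<open>u\<close>. It bounds the difference quotients of
  \<open>\<lambda>u. exp (- u * t)\<close> uniformly over \<open>{w..}\<close> by a function of \<open>t\<close> that is integrable for
  every Levy measure when \<open>w > 0\<close>.\<close>

lemma exp_diff_le:
  fixes u v w t :: real
  assumes "t > 0" "w \<le> u" "w \<le> v"
  shows "\<bar>exp (- u * t) - exp (- v * t)\<bar> \<le> t * exp (- w * t) * \<bar>u - v\<bar>"
proof -
  have "norm (exp (- u * t) - exp (- v * t)) \<le> t * exp (- w * t) * norm (u - v)"
  proof (rule field_differentiable_bound[where S = "{w..}" and f' = "\<lambda>x. - t * exp (- x * t)"])
    show "((\<lambda>x. exp (- x * t)) has_field_derivative - t * exp (- x * t)) (at x within {w..})" for x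
      by (auto intro!: derivative_eq_intros)
    show "norm (- t * exp (- x * t)) \<le> t * exp (- w * t)" if "x \<in> {w..}" for x
      using that assms(1) by (simp add: abs_mult)
  qed (use assms in auto)
  then show ?thesis by simp
qed

text \<open>Differentiation under the integral by dominated convergence along sequences. Staying to the
  right of \<open>u / 2\<close> keeps the difference quotients below the integrable function
  \<open>\<lambda>t. t * exp (- (u / 2) * t)\<close>.\<close>

lemma laplace_exponent_has_derivative:
  fixes \<phi> :: "real \<Rightarrow> real"
  assumes "levy_khintchine \<phi> \<gamma> \<mu>" and u: "u > 0"
  shows "(\<phi> has_real_derivative \<gamma> + (\<integral>t. t * exp (- u * t) \<partial>\<mu>)) (at u)"
proof -
  have levy: "is_levy_measure \<mu>"
    and \<phi>: "\<And>v. v > 0 \<Longrightarrow> \<phi> v = \<gamma> * v + (\<integral>t. 1 - exp (- v * t) \<partial>\<mu>)"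
    using assms(1) by (auto simp: levy_khintchine_def)
  have "((\<lambda>v. (\<phi> v - \<phi> u) / (v - u)) \<longlongrightarrow> \<gamma> + (\<integral>t. t * exp (- u * t) \<partial>\<mu>)) (at u within {u / 2<..})"
    unfolding tendsto_at_iff_sequentially
  proof (intro allI impI)
    fix X :: "nat \<Rightarrow> real"
    assume "\<forall>i. X i \<in> {u / 2<..} - {u}" and lim: "X \<longlonglongrightarrow> u"
    then have X: "X i > u / 2" "X i \<noteq> u" "X i > 0" for i
      using u by (auto intro: less_trans[of 0 "u / 2"])
    define q where "q i t = (exp (- u * t) - exp (- X i * t)) / (X i - u)" for i t
    have "(\<phi> (X i) - \<phi> u) / (X i - u) = \<gamma> + (\<integral>t. q i t \<partial>\<mu>)" for i
    proof -
      have "(\<integral>t. exp (- u * t) - exp (- X i * t) \<partial>\<mu>)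
          = (\<integral>t. (1 - exp (- X i * t)) - (1 - exp (- u * t)) \<partial>\<mu>)"
        by simp
      also have "\<dots> = (\<integral>t. 1 - exp (- X i * t) \<partial>\<mu>) - (\<integral>t. 1 - exp (- u * t) \<partial>\<mu>)"
        by (intro Bochner_Integration.integral_diff integrable_one_minus_exp levy u X)
      finally show ?thesis
        using X(2)[of i] by (simp add: \<phi>[OF u] \<phi>[OF X(3)] q_def field_simps)
    qed
    moreover have "(\<lambda>i. \<integral>t. q i t \<partial>\<mu>) \<longlonglongrightarrow> (\<integral>t. t * exp (- u * t) \<partial>\<mu>)"
    proof (rule integral_dominated_convergence)
      show "integrable \<mu> (\<lambda>t. t * exp (- (u / 2) * t))"
        using u by (intro integrable_mult_exp levy) simp
      show "(\<lambda>t. t * exp (- u * t)) \<in> borel_measurable \<mu>"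
        by (rule levy_measure_measurable[OF levy]) measurable
      show "q i \<in> borel_measurable \<mu>" for i
        unfolding q_def by (rule levy_measure_measurable[OF levy]) measurable
      show "AE t in \<mu>. (\<lambda>i. q i t) \<longlonglongrightarrow> t * exp (- u * t)"
      proof (rule AE_I2)
        fix t
        have "((\<lambda>v. - exp (- v * t)) has_real_derivative t * exp (- u * t)) (at u)"
          by (auto intro!: derivative_eq_intros)
        then have "((\<lambda>v. (- exp (- v * t) - - exp (- u * t)) / (v - u)) \<longlongrightarrow> t * exp (- u * t)) (at u)"
          by (simp add: has_field_derivative_iff)
        then have "((\<lambda>v. (- exp (- v * t) - - exp (- u * t)) / (v - u)) \<circ> X) \<longlonglongrightarrow> t * exp (- u * t)"
          using X lim unfolding tendsto_at_iff_sequentially by auto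
        then show "(\<lambda>i. q i t) \<longlonglongrightarrow> t * exp (- u * t)"
          by (simp add: q_def o_def)
      qed
      show "AE t in \<mu>. norm (q i t) \<le> t * exp (- (u / 2) * t)" for i
      proof (rule AE_I2)
        fix t assume "t \<in> space \<mu>"
        then have "t > 0" by (simp add: levy_measure_space[OF levy])
        then have "\<bar>exp (- u * t) - exp (- X i * t)\<bar> \<le> t * exp (- (u / 2) * t) * \<bar>u - X i\<bar>"
          using u X(1)[of i] by (intro exp_diff_le) auto
        then show "norm (q i t) \<le> t * exp (- (u / 2) * t)"
          using X(2)[of i] by (simp add: q_def abs_divide pos_divide_le_eq abs_minus_commute)
      qed
    qed
    ultimately show "((\<lambda>v. (\<phi> v - \<phi> u) / (v - u)) \<circ> X) \<longlonglongrightarrow> \<gamma> + (\<integral>t. t * exp (- u * t) \<partial>\<mu>)"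
      by (auto simp: o_def intro!: tendsto_add)
  qed
  moreover have "at u within {u / 2<..} = at u"
    using u by (intro at_within_open) auto
  ultimately show ?thesis
    by (simp add: has_field_derivative_iff)
qed

lemma has_density_measurable:
  assumes "has_density \<mu> m"
  shows "m \<in> borel_measurable (restrict_space lborel {0<..})"
proof -
  have "sets (restrict_space lborel {0::real<..}) = sets (restrict_space borel {0<..})"
    by (simp add: sets_restrict_space)
  from measurable_cong_sets[OF this refl] show ?thesis
    using assms unfolding has_density_def by metis
qed

text \<open>The integral is stated over the closed half-line, where the factor \<open>t\<close> makes the integrand
  vanish at \<open>0\<close> whatever the value \<open>m 0\<close>; this matches the closed domains of the explicit
  integrals of powers and exponentials with which it is compared.\<close>

lemma has_integral_density:
  fixes u :: real
  assumes "is_levy_measure \<mu>" "has_density \<mu> m" "u > 0"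
  shows "((\<lambda>t. t * exp (- u * t) * m t) has_integral (\<integral>t. t * exp (- u * t) \<partial>\<mu>)) {0..}"
proof -
  let ?R = "restrict_space lborel {0::real<..}"
  let ?f = "\<lambda>t. t * exp (- u * t)"
  have \<mu>: "\<mu> = density ?R (\<lambda>t. ennreal (m t))" and nn: "AE t in ?R. 0 \<le> m t"
    using assms(2) by (auto simp: has_density_def space_restrict_space intro!: AE_I2)
  note m = has_density_measurable[OF assms(2)]
  have f: "?f \<in> borel_measurable ?R"
    by (intro measurable_restrict_space1) measurable
  have "integrable ?R (\<lambda>t. m t *\<^sub>R ?f t)"
    using integrable_mult_exp[OF assms(1,3)] unfolding \<mu> integrable_density[OF f m nn] .
  then have "integrable lborel (\<lambda>t. indicator {0<..} t *\<^sub>R (m t *\<^sub>R ?f t))"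
    by (subst (asm) integrable_restrict_space) auto
  moreover have "(\<integral>t. ?f t \<partial>\<mu>) = (\<integral>t. indicator {0<..} t *\<^sub>R (m t *\<^sub>R ?f t) \<partial>lborel)"
    unfolding \<mu> integral_density[OF f m nn] by (subst integral_restrict_space) auto
  ultimately have "((\<lambda>t. indicator {0<..} t *\<^sub>R (m t *\<^sub>R ?f t)) has_integral (\<integral>t. ?f t \<partial>\<mu>)) UNIV"
    using has_integral_integral_lborel by metis
  moreover have "(\<lambda>t. indicator {0<..} t *\<^sub>R (m t *\<^sub>R ?f t))
      = (\<lambda>t. if t \<in> {0..} then t * exp (- u * t) * m t else 0)"
    by (auto simp: indicator_def fun_eq_iff)
  ultimately show ?thesis
    by (simp only: has_integral_restrict_UNIV)
qed

section \<open>Monotone densities and their Laplace transforms\<close>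

locale decreasing_density =
  fixes m L :: "real \<Rightarrow> real"
  assumes nonneg: "t > 0 \<Longrightarrow> 0 \<le> m t"
    and antimono: "0 < s \<Longrightarrow> s \<le> t \<Longrightarrow> m t \<le> m s"
    and transform: "u > 0 \<Longrightarrow> ((\<lambda>t. t * exp (- u * t) * m t) has_integral L u) {0..}"
begin

lemma transform_antimono:
  assumes "0 < u" "u \<le> v"
  shows "L v \<le> L u"
proof (rule has_integral_le[OF transform transform])
  fix t :: real assume "t \<in> {0..}"
  then show "t * exp (- v * t) * m t \<le> t * exp (- u * t) * m t"
    using assms nonneg[of t] by (cases "t = 0") (auto intro!: mult_right_mono mult_left_mono)
qed (use assms in auto)

text \<open>Keeping only \<open>{0..t}\<close>, where both the exponential and the density are at least their
  values at \<open>t\<close>, leaves the integral of \<open>s\<close> over this interval.\<close>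

lemma transform_ge:
  assumes "u > 0" "t > 0"
  shows "exp (- u * t) * m t * (t\<^sup>2 / 2) \<le> L u"
proof (rule has_integral_le[OF _ transform])
  have "((\<lambda>s. exp (- u * t) * m t * s) has_integral exp (- u * t) * m t * (t\<^sup>2 / 2)) {0..t}"
    using ident_has_integral[of 0 t] assms by (intro has_integral_mult_right) auto
  then show "((\<lambda>s. if s \<in> {0..t} then exp (- u * t) * m t * s else 0)
      has_integral exp (- u * t) * m t * (t\<^sup>2 / 2)) {0..}"
    by (subst has_integral_restrict) auto
  fix s :: real assume s: "s \<in> {0..}"
  show "(if s \<in> {0..t} then exp (- u * t) * m t * s else 0) \<le> s * exp (- u * s) * m s"
  proof (cases "0 < s \<and> s \<le> t")
    case True
    then have "exp (- u * t) * m t \<le> exp (- u * s) * m s"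
      using assms antimono[of s t] nonneg[of t] by (intro mult_mono) auto
    then show ?thesis
      using True by (simp add: mult_left_mono ac_simps)
  next
    case False
    then show ?thesis using s nonneg[of s] assms by (cases "s = 0") auto
  qed
qed (use assms in auto)

lemma transform_nonneg: "u > 0 \<Longrightarrow> 0 \<le> L u"
  using has_integral_nonneg[OF transform[of u]] nonneg by (force simp: less_le)

lemma transform_pos:
  assumes "u > 0" "t > 0" "m t > 0"
  shows "L u > 0"
proof -
  have "0 < exp (- u * t) * m t * (t\<^sup>2 / 2)"
    using assms by simp
  also have "\<dots> \<le> L u"
    using assms by (intro transform_ge)
  finally show ?thesis .
qed

lemma density_le:
  assumes "t > 0"
  shows "m t \<le> 2 * exp 1 * (t powr (- 2) * L (1 / t))"
proof -
  have "exp (- 1) * m t * (t\<^sup>2 / 2) \<le> L (1 / t)"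
    using transform_ge[of "1 / t" t] assms by simp
  then show ?thesis
    using assms by (simp add: powr_minus exp_minus field_simps)
qed

text \<open>The integrand is bounded by two functions with explicit integrals: on \<open>{0..b}\<close> by the
  assumed power, and beyond \<open>b\<close>, where the density is at most \<open>m b\<close>, by an exponential, since
  \<open>x * exp (- x) \<le> exp (- x / 2)\<close>. Adding the two bounds on the whole half-line avoids splitting
  the integral.\<close>

lemma transform_le:
  assumes u: "u > 0" and b: "b > 0" and "\<delta> > 0" "C \<ge> 0"
    and head: "\<And>s. 0 < s \<Longrightarrow> s \<le> b \<Longrightarrow> s * m s \<le> C * s powr (\<delta> - 1)"
  shows "L u \<le> C * (b powr \<delta> / \<delta>) + 2 * m b / u\<^sup>2"
proof (rule has_integral_le[OF transform])
  have "((\<lambda>s. C * s powr (\<delta> - 1)) has_integral C * (b powr \<delta> / \<delta>)) {0..b}"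
    using has_integral_powr_from_0[of "\<delta> - 1" b] assms by (intro has_integral_mult_right) auto
  then have near: "((\<lambda>s. if s \<in> {0..b} then C * s powr (\<delta> - 1) else 0)
      has_integral C * (b powr \<delta> / \<delta>)) {0..}"
    by (subst has_integral_restrict) auto
  have "((\<lambda>s. m b / u * exp (- (u / 2) * s)) has_integral m b / u * (exp (- (u / 2) * 0) / (u / 2))) {0..}"
    using u by (intro has_integral_mult_right has_integral_exp_minus_to_infinity) auto
  moreover have "m b / u * (exp (- (u / 2) * 0) / (u / 2)) = 2 * m b / u\<^sup>2"
    by (simp add: power2_eq_square)
  ultimately have far: "((\<lambda>s. m b / u * exp (- (u / 2) * s)) has_integral 2 * m b / u\<^sup>2) {0..}"
    by simp
  show "((\<lambda>s. (if s \<in> {0..b} then C * s powr (\<delta> - 1) else 0) + m b / u * exp (- (u / 2) * s))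
      has_integral C * (b powr \<delta> / \<delta>) + 2 * m b / u\<^sup>2) {0..}"
    by (rule has_integral_add[OF near far])
  fix s :: real assume s: "s \<in> {0..}"
  have mb: "0 \<le> m b" using b nonneg by simp
  consider "s = 0" | "0 < s" "s \<le> b" | "b < s" using s by force
  then show "s * exp (- u * s) * m s
      \<le> (if s \<in> {0..b} then C * s powr (\<delta> - 1) else 0) + m b / u * exp (- (u / 2) * s)"
  proof cases
    case 1
    then show ?thesis using mb u b by simp
  next
    case 2
    have "s * exp (- u * s) * m s \<le> s * m s"
      using 2 u nonneg[of s] by (intro mult_right_mono) auto
    also have "\<dots> \<le> C * s powr (\<delta> - 1)"
      using head 2 by simp
    also have "\<dots> \<le> C * s powr (\<delta> - 1) + m b / u * exp (- (u / 2) * s)"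
      using mb u by simp
    finally show ?thesis using 2 by simp
  next
    case 3
    \<comment> \<open>Squaring \<open>1 + x / 4 \<le> exp (x / 4)\<close> suffices, because \<open>(1 + x / 4)\<^sup>2 - x = (1 - x / 4)\<^sup>2\<close>.\<close>
    have "u * s \<le> exp (u * s / 2)"
    proof -
      have "1 + u * s / 4 \<le> exp (u * s / 4)" "0 \<le> u * s / 4"
        using exp_ge_add_one_self[of "u * s / 4"] u b 3 by auto
      then have "(1 + u * s / 4)\<^sup>2 \<le> (exp (u * s / 4))\<^sup>2"
        by (intro power_mono) auto
      moreover have "(exp (u * s / 4))\<^sup>2 = exp (u * s / 2)"
        by (simp add: exp_double[symmetric])
      moreover have "u * s \<le> (1 + u * s / 4)\<^sup>2"
        using zero_le_power2[of "1 - u * s / 4"] by (simp add: power2_eq_square algebra_simps)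
      ultimately show ?thesis by linarith
    qed
    then have "u * s * exp (- u * s) \<le> exp (u * s / 2) * exp (- u * s)"
      by (intro mult_right_mono) auto
    also have "\<dots> = exp (- (u / 2) * s)"
      by (simp add: exp_add[symmetric])
    finally have "s * exp (- u * s) \<le> exp (- (u / 2) * s) / u"
      using u by (simp add: field_simps)
    then have "s * exp (- u * s) * m s \<le> exp (- (u / 2) * s) / u * m b"
      using 3 b u antimono[of b s] nonneg[of s] by (intro mult_mono) auto
    then show ?thesis using 3 by (simp add: ac_simps)
  qed
qed (use u in auto)

text \<open>The decay condition makes the mass below \<open>a / u\<close> contribute a small fraction of
  \<open>L u\<close>, so at least half of \<open>L u\<close> comes from beyond \<open>a / u\<close>, where the density at \<open>a / u\<close>
  controls it.\<close>

lemma density_ge: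
  assumes \<sigma>: "\<sigma> > 0" and \<delta>: "\<delta> > 0" and u0: "u\<^sub>0 > 0"
    and decay: "\<And>x u. x \<ge> 1 \<Longrightarrow> u \<ge> u\<^sub>0 \<Longrightarrow> L (u * x) \<le> \<sigma> * x powr (- \<delta>) * L u"
  obtains a c where "a > 0" "c > 0" "\<And>t. 0 < t \<Longrightarrow> t \<le> a \<Longrightarrow> c * (t powr (- 2) * L (1 / t)) \<le> m t"
proof -
  define K where "K = 2 * exp 1 * \<sigma>"
  have K: "K > 0" using \<sigma> by (simp add: K_def)
  \<comment> \<open>The second entry solves \<open>K * (a powr \<delta> / \<delta>) = 1 / 2\<close>; the first puts \<open>a / t\<close> to the left of
    \<open>1 / t\<close>.\<close>
  define a where "a = min 1 ((\<delta> / (2 * K)) powr (1 / \<delta>))"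
  have a: "0 < a" "a \<le> 1"
    using K \<delta> by (auto simp: a_def)
  have "a powr \<delta> \<le> ((\<delta> / (2 * K)) powr (1 / \<delta>)) powr \<delta>"
    using a \<delta> by (intro powr_mono2) (auto simp: a_def)
  also have "\<dots> = \<delta> / (2 * K)"
    using K \<delta> by (simp add: powr_powr)
  finally have small: "K * (a powr \<delta> / \<delta>) \<le> 1 / 2"
    using K \<delta> by (simp add: field_simps)
  have "a\<^sup>2 / 4 * (t powr (- 2) * L (1 / t)) \<le> m t" if t: "0 < t" "t \<le> a / u\<^sub>0" for t
  proof -
    define u where "u = a / t"
    have u: "u > 0" "u \<ge> u\<^sub>0" "t = a / u"
      using a t u0 by (auto simp: u_def field_simps)
    have Lu: "0 \<le> L u"
      using transform_nonneg u by simp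
    have "L u \<le> K * u powr \<delta> * L u * (t powr \<delta> / \<delta>) + 2 * m t / u\<^sup>2"
    proof (rule transform_le)
      fix s assume s: "0 < s" "s \<le> t"
      have us: "1 \<le> 1 / (u * s)"
      proof -
        have "u * s \<le> u * t" using s u by (intro mult_left_mono) auto
        also have "u * t \<le> 1" using a t by (simp add: u_def)
        finally show ?thesis using s u by simp
      qed
      \<comment> \<open>The decay condition compares \<open>L (1 / s)\<close> with \<open>L u\<close> through the ratio \<open>x = 1 / (u * s)\<close>,
        which is at least \<open>1\<close> because \<open>u * s \<le> u * t = a \<le> 1\<close>.\<close>
      have "s * m s \<le> s * (2 * exp 1 * (s powr (- 2) * L (u * (1 / (u * s)))))"
        using s u density_le[of s] by simp
      also have "\<dots> \<le> s * (2 * exp 1 * (s powr (- 2) * (\<sigma> * (1 / (u * s)) powr (- \<delta>) * L u)))"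
        using s decay[OF us u(2)] by (intro mult_left_mono) auto
      also have "(1 / (u * s)) powr (- \<delta>) = u powr \<delta> * s powr \<delta>"
        using s u by (simp add: powr_divide powr_mult powr_minus field_simps)
      also have "s * (2 * exp 1 * (s powr (- 2) * (\<sigma> * (u powr \<delta> * s powr \<delta>) * L u)))
          = K * u powr \<delta> * L u * (s powr 1 * s powr (- 2) * s powr \<delta>)"
        using s by (simp add: K_def)
      also have "s powr 1 * s powr (- 2) * s powr \<delta> = s powr (1 + - 2 + \<delta>)"
        by (simp only: powr_add)
      also have "1 + - 2 + \<delta> = \<delta> - 1"
        by simp
      finally show "s * m s \<le> K * u powr \<delta> * L u * s powr (\<delta> - 1)" .
    qed (use u t K Lu \<delta> in auto)
    also have "K * u powr \<delta> * L u * (t powr \<delta> / \<delta>) = K * (a powr \<delta> / \<delta>) * L u"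
      using a t by (simp add: u_def powr_divide)
    also have "\<dots> \<le> 1 / 2 * L u"
      by (rule mult_right_mono[OF small Lu])
    finally have "L u \<le> 4 * m t / u\<^sup>2"
      by simp
    then have "L u \<le> 4 * m t * t\<^sup>2 / a\<^sup>2"
      by (simp add: u_def power_divide)
    moreover have "L (1 / t) \<le> L u"
      using a t by (intro transform_antimono) (auto simp: u_def divide_right_mono)
    ultimately have "L (1 / t) \<le> 4 * m t * t\<^sup>2 / a\<^sup>2"
      by linarith
    then show ?thesis
      using a t by (simp add: powr_minus field_simps)
  qed
  then show ?thesis
    using a u0 that[of "a / u\<^sub>0" "a\<^sup>2 / 4"] by auto
qed

end

section \<open>Comparison of the density with the derivative of the exponent\<close>

text \<open>A point where the density is positive makes \<open>L\<close> strictly positive, so that dividing by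
  the derivative of the exponent is legitimate.\<close>

lemma infinite_density_pos:
  assumes "has_density \<mu> m" "emeasure \<mu> {0<..} = \<infinity>"
  obtains t where "t > 0" "m t > 0"
proof (rule ccontr)
  assume "\<not> thesis"
  then have zero: "m t = 0" if "t > 0" for t
    using that assms(1) \<open>\<And>t. 0 < t \<Longrightarrow> 0 < m t \<Longrightarrow> thesis\<close> by (force simp: has_density_def)
  have "\<mu> = density (restrict_space lborel {0<..}) (\<lambda>t. ennreal (m t))"
    using assms(1) by (simp add: has_density_def)
  also have "\<dots> = density (restrict_space lborel {0<..}) (\<lambda>_. 0)"
  proof (rule density_cong)
    show "(\<lambda>t. ennreal (m t)) \<in> borel_measurable (restrict_space lborel {0<..})"
      using has_density_measurable[OF assms(1)] by measurable
  qed (auto simp: zero space_restrict_space)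
  finally have "\<mu> = density (restrict_space lborel {0<..}) (\<lambda>_. 0)" .
  moreover have "emeasure (density (restrict_space lborel {0<..}) (\<lambda>_. 0)) {0::real<..} = 0"
    by (subst emeasure_density) (auto simp: sets_restrict_space)
  ultimately show False
    using assms(2) by simp
qed

theorem proposition2p3:
  fixes M :: "'a measure" and S :: "real \<Rightarrow> 'a \<Rightarrow> real"
    and \<phi> :: "real \<Rightarrow> real" and \<gamma> :: real and \<mu> :: "real measure" and m :: "real \<Rightarrow> real"
  assumes "subordinator M S"
    and "is_laplace_exponent M S \<phi>"
    and "levy_khintchine \<phi> \<gamma> \<mu>"
    and "emeasure \<mu> {0<..} = \<infinity>"
    and "has_density \<mu> m"
    and "antimono_on {0<..} m"
    and "\<exists>\<sigma>>0. \<exists>u\<^sub>0>0. \<exists>\<delta>>0. \<forall>x\<ge>1. \<forall>u\<ge>u\<^sub>0.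
           deriv \<phi> (u * x) / deriv \<phi> u \<le> \<sigma> * x powr (- \<delta>)"
  shows "comparable (at_right 0) m (\<lambda>t. t powr (- 2) * deriv \<phi> (1 / t))"
proof -
  define L where "L u = (\<integral>t. t * exp (- u * t) \<partial>\<mu>)" for u :: real
  have levy: "is_levy_measure \<mu>" and \<gamma>: "\<gamma> \<ge> 0"
    using assms(3) by (auto simp: levy_khintchine_def)
  have deriv: "deriv \<phi> u = \<gamma> + L u" if "u > 0" for u
    unfolding L_def by (rule DERIV_imp_deriv[OF laplace_exponent_has_derivative[OF assms(3) that]])
  interpret decreasing_density m L
  proof
    show "0 \<le> m t" if "t > 0" for t
      using assms(5) that by (simp add: has_density_def)
    show "m t \<le> m s" if "0 < s" "s \<le> t" for s t
      using assms(6) that by (auto simp: monotone_on_def)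
    show "((\<lambda>t. t * exp (- u * t) * m t) has_integral L u) {0..}" if "u > 0" for u
      unfolding L_def by (rule has_integral_density[OF levy assms(5) that])
  qed
  obtain t\<^sub>1 where t1: "t\<^sub>1 > 0" "m t\<^sub>1 > 0"
    using infinite_density_pos[OF assms(5,4)] .
  have L_pos: "L u > 0" if "u > 0" for u
    using transform_pos[OF that t1] .
  obtain \<sigma> u\<^sub>0 \<delta> where pos: "\<sigma> > 0" "u\<^sub>0 > 0" "\<delta> > 0"
    and A3: "\<And>x u. x \<ge> 1 \<Longrightarrow> u \<ge> u\<^sub>0 \<Longrightarrow> deriv \<phi> (u * x) / deriv \<phi> u \<le> \<sigma> * x powr (- \<delta>)"
    using assms(7) by blast
  have decay: "\<gamma> + L (u * x) \<le> \<sigma> * x powr (- \<delta>) * (\<gamma> + L u)" if "x \<ge> 1" "u \<ge> u\<^sub>0" for x u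
    using A3[OF that] deriv[of u] deriv[of "u * x"] L_pos[of u] \<gamma> that pos
    by (simp add: pos_divide_le_eq)
  \<comment> \<open>The drift is a lower bound for \<open>\<phi>'\<close>, which the decay condition sends to \<open>0\<close>.\<close>
  have "\<gamma> \<le> 0"
  proof (rule tendsto_le)
    have "((\<lambda>x. \<sigma> * x powr (- \<delta>) * (\<gamma> + L u\<^sub>0)) \<longlongrightarrow> \<sigma> * 0 * (\<gamma> + L u\<^sub>0)) at_top"
      using pos by (intro tendsto_intros tendsto_neg_powr filterlim_ident) auto
    then show "((\<lambda>x. \<sigma> * x powr (- \<delta>) * (\<gamma> + L u\<^sub>0)) \<longlongrightarrow> 0) at_top"
      by simp
    show "\<forall>\<^sub>F x in at_top. \<gamma> \<le> \<sigma> * x powr (- \<delta>) * (\<gamma> + L u\<^sub>0)"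
      using eventually_ge_at_top[of 1]
    proof eventually_elim
      case (elim x)
      then show ?case
        using decay[of x u\<^sub>0] L_pos[of "u\<^sub>0 * x"] pos by auto
    qed
  qed auto
  then have "\<gamma> = 0"
    using \<gamma> by simp
  then obtain a c where ac: "a > 0" "c > 0"
      and lower: "\<And>t. 0 < t \<Longrightarrow> t \<le> a \<Longrightarrow> c * (t powr (- 2) * L (1 / t)) \<le> m t"
    using density_ge[OF pos(1,3,2)] decay by auto
  have "\<forall>\<^sub>F t in at_right 0. c \<le> m t / (t powr (- 2) * deriv \<phi> (1 / t))
      \<and> m t / (t powr (- 2) * deriv \<phi> (1 / t)) \<le> 2 * exp 1"
    using eventually_at_right_real[OF ac(1)]
  proof eventually_elim
    case (elim t)
    then have t: "0 < t" "t \<le> a" by auto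
    moreover have "t powr (- 2) * L (1 / t) > 0"
      using t L_pos by simp
    ultimately show ?case
      using lower[OF t] density_le[OF t(1)] deriv[of "1 / t"] \<open>\<gamma> = 0\<close>
      by (simp only: pos_le_divide_eq pos_divide_le_eq zero_less_divide_1_iff add_0_left simp_thms)
  qed
  then show ?thesis
    using ac unfolding comparable_def by (intro exI[of _ c] conjI exI[of _ "2 * exp 1 :: real"]) auto
qed

end
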